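(* Let $\mathbb{D} : \mathcal{J} \to \mathrm{Cat}$ be a diagram of categories and let $\overline{\mathbb{D}} = \lim_{j \in \mathcal{J}} \mathbb{D}_j$ with limiting legs $((-)|_j : \overline{\mathbb{D}} \to \mathbb{D}_j)_{j \in \mathcal{J}}$. Suppose: - each limiting leg $(-)|_j : \overline{\mathbb{D}} \to \mathbb{D}_j$ preserves pullbacks; - each $\mathbb{D}_j$ is equipped with a subobject classifier $\Omega_j$, a terminal object $1_j$ and a truth map $\mathrm{true}_j : 1_j \to \Omega_j$; - for each $\alpha : j \to j'$ in $\mathcal{J}$, the functorial action $\alpha^* := \mathbb{D}_\alpha : \mathbb{D}_j \to \mathbb{D}_{j'}$ preserves pullbacks and moreover $\alpha^*\mathrm{true}_j = \mathrm{true}_{j'}$ (in particular $\alpha^*$ preserves the terminal object and subobject classifier). Then $\overline{\mathbb{D}}$ admits: - a terminal object $1$ such that $1|_j = 1_j$ for each $j$; - a unique object $\Omega \in \overline{\mathbb{D}}$ such that $\Omega|_j = \Omega_j$ for each $j$; - a unique map $\mathrm{true} : 1 \to \Omega$ such that $\mathrm{true}|_j = \mathrm{true}_j$ for each $j$, which serves as the truth map making $\Omega$ into a subobject classifier of $\overline{\mathbb{D}}$.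
   Context: The limit $\lim_{j} \mathbb{D}_j$ is the (strict) limit in the category $\mathrm{Cat}$ of categories and functors. A subobject classifier with truth map $\mathrm{true} : 1 \to \Omega$ is such that every mono $m : c \hookrightarrow d$ is the pullback of $\mathrm{true}$ along a unique map $d \to \Omega$. *)

theory Defs
  imports "HOL-Library.FuncSet"
begin

record ('o, 'a) cat =
  Obj :: "'o set"
  Arr :: "'a set"
  Dom :: "'a \<Rightarrow> 'o"
  Cod :: "'a \<Rightarrow> 'o"
  Ident :: "'o \<Rightarrow> 'a"
  Comp :: "'a \<Rightarrow> 'a \<Rightarrow> 'a"

text \<open>\<open>Comp C g f\<close> is the composite of \<open>g\<close> after \<open>f\<close>; its value is irrelevant when
  \<open>g\<close> and \<open>f\<close> are not composable.\<close>

definition hom :: "('o, 'a) cat \<Rightarrow> 'o \<Rightarrow> 'o \<Rightarrow> 'a set" where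
  "hom C x y = {f \<in> Arr C. Dom C f = x \<and> Cod C f = y}"

locale category =
  fixes C :: "('o, 'a) cat"
  assumes Dom_Obj: "f \<in> Arr C \<Longrightarrow> Dom C f \<in> Obj C"
    and Cod_Obj: "f \<in> Arr C \<Longrightarrow> Cod C f \<in> Obj C"
    and Ident_hom: "x \<in> Obj C \<Longrightarrow> Ident C x \<in> hom C x x"
    and Comp_hom: "f \<in> hom C x y \<Longrightarrow> g \<in> hom C y z \<Longrightarrow> Comp C g f \<in> hom C x z"
    and Comp_Ident_left: "f \<in> hom C x y \<Longrightarrow> Comp C (Ident C y) f = f"
    and Comp_Ident_right: "f \<in> hom C x y \<Longrightarrow> Comp C f (Ident C x) = f"
    and Comp_assoc: "f \<in> hom C w x \<Longrightarrow> g \<in> hom C x y \<Longrightarrow> h \<in> hom C y z \<Longrightarrow>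
      Comp C h (Comp C g f) = Comp C (Comp C h g) f"

definition is_mono :: "('o, 'a) cat \<Rightarrow> 'a \<Rightarrow> bool" where
  "is_mono C m \<longleftrightarrow> m \<in> Arr C \<and>
    (\<forall>x. \<forall>f \<in> hom C x (Dom C m). \<forall>g \<in> hom C x (Dom C m). Comp C m f = Comp C m g \<longrightarrow> f = g)"

definition is_terminal :: "('o, 'a) cat \<Rightarrow> 'o \<Rightarrow> bool" where
  "is_terminal C t \<longleftrightarrow> t \<in> Obj C \<and> (\<forall>x \<in> Obj C. \<exists>!f. f \<in> hom C x t)"

text \<open>\<open>is_pullback C p q f g\<close>: the square with projections \<open>p : P \<rightarrow> X\<close>, \<open>q : P \<rightarrow> Y\<close> over the
  cospan \<open>f : X \<rightarrow> Z\<close>, \<open>g : Y \<rightarrow> Z\<close> is a pullback; \<open>p\<close> is then the pullback of \<open>g\<close> along \<open>f\<close>.\<close>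

definition is_pullback :: "('o, 'a) cat \<Rightarrow> 'a \<Rightarrow> 'a \<Rightarrow> 'a \<Rightarrow> 'a \<Rightarrow> bool" where
  "is_pullback C p q f g \<longleftrightarrow>
    p \<in> Arr C \<and> q \<in> Arr C \<and> f \<in> Arr C \<and> g \<in> Arr C \<and>
    Dom C p = Dom C q \<and> Cod C p = Dom C f \<and> Cod C q = Dom C g \<and> Cod C f = Cod C g \<and>
    Comp C f p = Comp C g q \<and>
    (\<forall>w. \<forall>a \<in> hom C w (Dom C f). \<forall>b \<in> hom C w (Dom C g). Comp C f a = Comp C g b \<longrightarrow>
      (\<exists>!u. u \<in> hom C w (Dom C p) \<and> Comp C p u = a \<and> Comp C q u = b))"

definition is_subobject_classifier :: "('o, 'a) cat \<Rightarrow> 'o \<Rightarrow> 'o \<Rightarrow> 'a \<Rightarrow> bool" where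
  "is_subobject_classifier C t \<Omega> tr \<longleftrightarrow>
    is_terminal C t \<and> \<Omega> \<in> Obj C \<and> tr \<in> hom C t \<Omega> \<and>
    (\<forall>m. is_mono C m \<longrightarrow>
      (\<exists>!\<chi>. \<chi> \<in> hom C (Cod C m) \<Omega> \<and> (\<exists>u \<in> hom C (Dom C m) t. is_pullback C m u \<chi> tr)))"

record ('o, 'a, 'p, 'b) funct =
  Src :: "('o, 'a) cat"
  Tgt :: "('p, 'b) cat"
  FObj :: "'o \<Rightarrow> 'p"
  FArr :: "'a \<Rightarrow> 'b"

text \<open>The two maps of a functor are extensional (\<open>undefined\<close> off the source category), so that
  equality of records is equality of functors.\<close>

locale is_functor =
  fixes F :: "('o, 'a, 'p, 'b) funct"
  assumes category_Src: "category (Src F)"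
    and category_Tgt: "category (Tgt F)"
    and FObj_funcset: "FObj F \<in> Obj (Src F) \<rightarrow>\<^sub>E Obj (Tgt F)"
    and FArr_extensional: "FArr F \<in> extensional (Arr (Src F))"
    and FArr_hom: "f \<in> hom (Src F) x y \<Longrightarrow> FArr F f \<in> hom (Tgt F) (FObj F x) (FObj F y)"
    and FArr_Ident: "x \<in> Obj (Src F) \<Longrightarrow> FArr F (Ident (Src F) x) = Ident (Tgt F) (FObj F x)"
    and FArr_Comp: "f \<in> hom (Src F) x y \<Longrightarrow> g \<in> hom (Src F) y z \<Longrightarrow>
      FArr F (Comp (Src F) g f) = Comp (Tgt F) (FArr F g) (FArr F f)"

definition preserves_pullbacks :: "('o, 'a, 'p, 'b) funct \<Rightarrow> bool" where
  "preserves_pullbacks F \<longleftrightarrow> (\<forall>p q f g. is_pullback (Src F) p q f g \<longrightarrow>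
    is_pullback (Tgt F) (FArr F p) (FArr F q) (FArr F f) (FArr F g))"

definition id_functor :: "('o, 'a) cat \<Rightarrow> ('o, 'a, 'o, 'a) funct" where
  "id_functor C = \<lparr>Src = C, Tgt = C, FObj = (\<lambda>x \<in> Obj C. x), FArr = (\<lambda>f \<in> Arr C. f)\<rparr>"

definition comp_functor ::
    "('p, 'b, 'r, 'c) funct \<Rightarrow> ('o, 'a, 'p, 'b) funct \<Rightarrow> ('o, 'a, 'r, 'c) funct" where
  "comp_functor G F = \<lparr>Src = Src F, Tgt = Tgt G,
    FObj = compose (Obj (Src F)) (FObj G) (FObj F),
    FArr = compose (Arr (Src F)) (FArr G) (FArr F)\<rparr>"

text \<open>The types \<open>'o\<close> and \<open>'a\<close> play the role of the universe: \<open>Cat\<close> is the category of all categories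
  whose objects are drawn from \<open>'o\<close> and whose arrows are drawn from \<open>'a\<close>.\<close>

definition Cat :: "(('o, 'a) cat, ('o, 'a, 'o, 'a) funct) cat" where
  "Cat = \<lparr>Obj = {C. category C}, Arr = {F. is_functor F}, Dom = Src, Cod = Tgt,
    Ident = id_functor, Comp = comp_functor\<rparr>"

lemma is_functor_id:
  assumes "category C"
  shows "is_functor (id_functor C)"
proof -
  interpret category C by fact
  have "Comp C g f \<in> Arr C" if "f \<in> hom C x y" "g \<in> hom C y z" for f g x y z
    using Comp_hom[OF that] by (simp add: hom_def)
  moreover have "Ident C x \<in> Arr C" if "x \<in> Obj C" for x
    using Ident_hom[OF that] by (simp add: hom_def)
  moreover have "f \<in> Arr C" "x \<in> Obj C" "y \<in> Obj C" if "f \<in> hom C x y" for f x y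
    using that by (auto simp: hom_def Dom_Obj Cod_Obj)
  ultimately show ?thesis
    using assms by (intro is_functor.intro) (auto simp: id_functor_def)
qed

lemma is_functor_comp:
  assumes "is_functor F" "is_functor G" "Src G = Tgt F"
  shows "is_functor (comp_functor G F)"
proof -
  interpret F: is_functor F by fact
  interpret G: is_functor G by fact
  interpret S: category "Src F" by (rule F.category_Src)
  have Comp_Arr: "Comp (Src F) g f \<in> Arr (Src F)"
    if "f \<in> hom (Src F) x y" "g \<in> hom (Src F) y z" for f g x y z
    using S.Comp_hom[OF that] by (simp add: hom_def)
  have Ident_Arr: "Ident (Src F) x \<in> Arr (Src F)" if "x \<in> Obj (Src F)" for x
    using S.Ident_hom[OF that] by (simp add: hom_def)
  have homD: "f \<in> Arr (Src F)" "x \<in> Obj (Src F)" "y \<in> Obj (Src F)"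
    if "f \<in> hom (Src F) x y" for f x y
    using that by (auto simp: hom_def S.Dom_Obj S.Cod_Obj)
  have FObj_in: "FObj F x \<in> Obj (Src G)" if "x \<in> Obj (Src F)" for x
    using F.FObj_funcset that assms(3) by auto
  have GObj_in: "FObj G y \<in> Obj (Tgt G)" if "y \<in> Obj (Src G)" for y
    using G.FObj_funcset that by auto
  have FArr_in: "FArr F f \<in> hom (Src G) (FObj F x) (FObj F y)"
    if "f \<in> hom (Src F) x y" for f x y
    using F.FArr_hom[OF that] assms(3) by simp
  show ?thesis
  proof (rule is_functor.intro, goal_cases)
    case 1
    show ?case using F.category_Src by (simp add: comp_functor_def)
  next
    case 2
    show ?case using G.category_Tgt by (simp add: comp_functor_def)
  next
    case 3
    show ?case by (auto simp: comp_functor_def compose_def intro!: GObj_in FObj_in)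
  next
    case 4
    show ?case by (simp add: comp_functor_def)
  next
    case (5 f x y)
    then have f: "f \<in> hom (Src F) x y" by (simp add: comp_functor_def)
    show ?case
      using G.FArr_hom[OF FArr_in[OF f]] homD[OF f] by (simp add: comp_functor_def compose_def)
  next
    case (6 x)
    then have x: "x \<in> Obj (Src F)" by (simp add: comp_functor_def)
    show ?case
      using G.FArr_Ident[OF FObj_in[OF x]] x
      by (simp add: comp_functor_def compose_def Ident_Arr F.FArr_Ident assms(3))
  next
    case (7 f x y g z)
    then have f: "f \<in> hom (Src F) x y" and g: "g \<in> hom (Src F) y z"
      by (simp_all add: comp_functor_def)
    show ?case
      using G.FArr_Comp[OF FArr_in[OF f] FArr_in[OF g]] homD[OF f] homD[OF g]
        Comp_Arr[OF f g] F.FArr_Comp[OF f g]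
      by (simp add: comp_functor_def compose_def assms(3))
  qed
qed

lemma category_Cat: "category (Cat :: (('o, 'a) cat, ('o, 'a, 'o, 'a) funct) cat)"
proof -
  have maps: "FArr F f \<in> Arr (Tgt F)" if "is_functor F" "f \<in> Arr (Src F)"
    for F :: "('o, 'a, 'o, 'a) funct" and f
    using is_functor.FArr_hom[OF that(1), of f "Dom (Src F) f" "Cod (Src F) f"] that(2)
    by (simp add: hom_def)
  have ext: "FObj F \<in> extensional (Obj (Src F))" "FArr F \<in> extensional (Arr (Src F))"
    if "is_functor F" for F :: "('o, 'a, 'o, 'a) funct"
    using is_functor.FObj_funcset[OF that] is_functor.FArr_extensional[OF that]
    by (auto simp: PiE_def)
  have obj: "FObj F x \<in> Obj (Tgt F)" if "is_functor F" "x \<in> Obj (Src F)"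
    for F :: "('o, 'a, 'o, 'a) funct" and x
    using is_functor.FObj_funcset[OF that(1)] that(2) by auto
  show ?thesis
  proof (rule category.intro, goal_cases)
    case (1 F)
    then show ?case by (simp add: Cat_def is_functor.category_Src)
  next
    case (2 F)
    then show ?case by (simp add: Cat_def is_functor.category_Tgt)
  next
    case (3 C)
    then show ?case using is_functor_id[of C] by (simp add: Cat_def hom_def id_functor_def)
  next
    case (4 F C D G E)
    then show ?case using is_functor_comp[of F G]
      by (simp add: Cat_def hom_def) (simp add: comp_functor_def)
  next
    case (5 F C D)
    then have F: "is_functor F" "Tgt F = D" by (auto simp: Cat_def hom_def)
    have "compose (Obj (Src F)) (\<lambda>x \<in> Obj D. x) (FObj F) = FObj F"
      "compose (Arr (Src F)) (\<lambda>f \<in> Arr D. f) (FArr F) = FArr F"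
      using ext[OF F(1)] obj[OF F(1)] maps[OF F(1)] F(2)
      by (auto simp: compose_def restrict_def extensional_def fun_eq_iff)
    then show ?case by (simp add: Cat_def id_functor_def comp_functor_def flip: F(2))
  next
    case (6 F C D)
    then have F: "is_functor F" "Src F = C" by (auto simp: Cat_def hom_def)
    have "compose (Obj C) (FObj F) (\<lambda>x \<in> Obj C. x) = FObj F"
      "compose (Arr C) (FArr F) (\<lambda>f \<in> Arr C. f) = FArr F"
      using ext[OF F(1)] F(2)
      by (auto simp: compose_def restrict_def extensional_def fun_eq_iff)
    then show ?case by (simp add: Cat_def id_functor_def comp_functor_def flip: F(2))
  next
    case (7 F B C G D H E)
    then have F: "is_functor F" "Tgt F = Src G" by (auto simp: Cat_def hom_def)
    show ?case
      using obj[OF F(1)] maps[OF F(1)] F(2)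
      by (auto simp: Cat_def comp_functor_def compose_def fun_eq_iff)
  qed
qed

definition is_cone ::
    "('i, 'k, 'p, 'b) funct \<Rightarrow> 'p \<Rightarrow> ('i \<Rightarrow> 'b) \<Rightarrow> bool" where
  "is_cone D X \<pi> \<longleftrightarrow> X \<in> Obj (Tgt D) \<and>
    (\<forall>j \<in> Obj (Src D). \<pi> j \<in> hom (Tgt D) X (FObj D j)) \<and>
    (\<forall>\<alpha> \<in> Arr (Src D).
      Comp (Tgt D) (FArr D \<alpha>) (\<pi> (Dom (Src D) \<alpha>)) = \<pi> (Cod (Src D) \<alpha>))"

definition is_limit ::
    "('i, 'k, 'p, 'b) funct \<Rightarrow> 'p \<Rightarrow> ('i \<Rightarrow> 'b) \<Rightarrow> bool" where
  "is_limit D L \<pi> \<longleftrightarrow> is_cone D L \<pi> \<and>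
    (\<forall>X \<xi>. is_cone D X \<xi> \<longrightarrow>
      (\<exists>!u. u \<in> hom (Tgt D) X L \<and> (\<forall>j \<in> Obj (Src D). Comp (Tgt D) (\<pi> j) u = \<xi> j)))"

end

theory Submission
  imports Defs
begin

text \<open>Objects and arrows of a strict limit of categories are compatible families of objects and
  arrows, because an object is a functor out of the point and an arrow is a functor out of the
  walking arrow. Every structure at stake is determined by a universal property, so the componentwise
  terminal maps, characteristic maps and mediating maps of pullbacks are automatically compatible
  and hence lift to the limit.

  Since the universe of \<open>Cat\<close> is given by two types, the walking arrow exists only if these
  have at least two, respectively three elements. This fails only if every category with a
  terminal object in that universe is trivial, and then so is the limit.\<close>

section \<open>Hom-sets, monos as pullbacks, and functors that preserve monos\<close>

lemma hom_Arr:
  assumes "f \<in> Arr C"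
  shows "f \<in> hom C (Dom C f) (Cod C f)"
  using assms by (simp add: hom_def)

lemma homD:
  assumes "f \<in> hom C x y"
  shows "f \<in> Arr C" "Dom C f = x" "Cod C f = y"
  using assms by (auto simp: hom_def)

lemma (in category) hom_Obj:
  assumes "f \<in> hom C x y"
  shows "x \<in> Obj C" "y \<in> Obj C"
  using assms Dom_Obj Cod_Obj by (auto simp: hom_def)

text \<open>A pair of maps identified by \<open>m\<close> is a cone over the cospan
  \<open>m\<close>, \<open>m\<close>, and a mediating map into the identity square must equal both
  members of the pair. In this form being mono is visible to functors that preserve
  pullbacks.\<close>

lemma (in category) is_mono_iff_pullback:
  assumes "m \<in> Arr C"
  shows "is_mono C m \<longleftrightarrow> is_pullback C (Ident C (Dom C m)) (Ident C (Dom C m)) m m"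
proof -
  let ?i = "Ident C (Dom C m)"
  have i: "?i \<in> hom C (Dom C m) (Dom C m)"
    using Ident_hom[OF Dom_Obj[OF assms]] .
  show ?thesis
  proof
    assume m: "is_mono C m"
    have "\<exists>!u. u \<in> hom C w (Dom C m) \<and> Comp C ?i u = a \<and> Comp C ?i u = b"
      if "a \<in> hom C w (Dom C m)" "b \<in> hom C w (Dom C m)" "Comp C m a = Comp C m b" for w a b
    proof -
      have "a = b" using m that by (auto simp: is_mono_def)
      with that(1) Comp_Ident_left show ?thesis by metis
    qed
    with assms homD[OF i] show "is_pullback C ?i ?i m m"
      by (auto simp: is_pullback_def)
  next
    assume p: "is_pullback C ?i ?i m m"
    have "f = g" if f: "f \<in> hom C x (Dom C m)" and g: "g \<in> hom C x (Dom C m)"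
      and "Comp C m f = Comp C m g" for x f g
    proof -
      have "\<exists>u. u \<in> hom C x (Dom C ?i) \<and> Comp C ?i u = f \<and> Comp C ?i u = g"
        using p that unfolding is_pullback_def by blast
      then show ?thesis by auto
    qed
    then show "is_mono C m" using assms by (auto simp: is_mono_def)
  qed
qed

context is_functor
begin

lemma FObj_Obj: "x \<in> Obj (Src F) \<Longrightarrow> FObj F x \<in> Obj (Tgt F)"
  using FObj_funcset by auto

lemma FArr_Arr:
  assumes "f \<in> Arr (Src F)"
  shows "FArr F f \<in> Arr (Tgt F)"
    and "Dom (Tgt F) (FArr F f) = FObj F (Dom (Src F) f)"
    and "Cod (Tgt F) (FArr F f) = FObj F (Cod (Src F) f)"
  using homD[OF FArr_hom[OF hom_Arr[OF assms]]] by auto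

text \<open>The identity square over \<open>m\<close> is a pullback, and its image is the identity
  square over \<open>FArr F m\<close> because a functor preserves identities.\<close>

lemma preserves_mono:
  assumes "preserves_pullbacks F" "is_mono (Src F) m"
  shows "is_mono (Tgt F) (FArr F m)"
proof -
  interpret S: category "Src F" by (rule category_Src)
  interpret T: category "Tgt F" by (rule category_Tgt)
  have m: "m \<in> Arr (Src F)" using assms(2) by (simp add: is_mono_def)
  let ?i = "Ident (Src F) (Dom (Src F) m)"
  have "is_pullback (Src F) ?i ?i m m"
    using assms(2) S.is_mono_iff_pullback[OF m] by simp
  then have "is_pullback (Tgt F) (FArr F ?i) (FArr F ?i) (FArr F m) (FArr F m)"
    using assms(1) unfolding preserves_pullbacks_def by blast
  then show ?thesis
    using T.is_mono_iff_pullback[OF FArr_Arr(1)[OF m]] FArr_Ident[OF S.Dom_Obj[OF m]]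
    by (simp add: FArr_Arr(2)[OF m])
qed

end

section \<open>Consequences of terminality and of the universal properties\<close>

lemma is_terminal_eqI:
  assumes "is_terminal C t" "x \<in> Obj C" "f \<in> hom C x t" "g \<in> hom C x t"
  shows "f = g"
  using assms by (auto simp: is_terminal_def)

lemma is_subobject_classifier_ex1:
  assumes "is_subobject_classifier C t \<Omega> tr" "is_mono C m"
  shows "\<exists>!\<chi>. \<chi> \<in> hom C (Cod C m) \<Omega> \<and> (\<exists>u \<in> hom C (Dom C m) t. is_pullback C m u \<chi> tr)"
  using assms unfolding is_subobject_classifier_def by blast

lemma is_pullback_ex1:
  assumes "is_pullback C p q f g"
    and "a \<in> hom C w (Dom C f)" "b \<in> hom C w (Dom C g)" "Comp C f a = Comp C g b"
  shows "\<exists>!u. u \<in> hom C w (Dom C p) \<and> Comp C p u = a \<and> Comp C q u = b"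
  using assms unfolding is_pullback_def by blast

text \<open>An object other than \<open>t\<close> would supply a second object and, through its map
  to \<open>t\<close>, three arrows told apart by their domains and codomains. If the types cannot
  hold these, \<open>t\<close> is the only object and every arrow is an endomorphism of a terminal
  object.\<close>

lemma (in category) trivial_if_terminal:
  assumes "is_terminal C t"
    and small: "\<not> (\<exists>x y :: 'o. x \<noteq> y) \<or> \<not> (\<exists>p q r :: 'a. distinct [p, q, r])"
    and "f \<in> Arr C" "g \<in> Arr C"
  shows "f = g"
proof -
  have t: "t \<in> Obj C" using assms(1) by (simp add: is_terminal_def)
  have eq: "x = t" if x: "x \<in> Obj C" for x
  proof (rule ccontr)
    assume ne: "x \<noteq> t"
    obtain h where "h \<in> hom C x t" using assms(1) x by (auto simp: is_terminal_def)
    then have "distinct [Ident C x, Ident C t, h]"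
      using homD[OF Ident_hom[OF x]] homD[OF Ident_hom[OF t]] homD[of h C x t] ne by auto
    with small ne show False by blast
  qed
  have "f \<in> hom C t t" "g \<in> hom C t t"
    using assms(3,4) eq[OF Dom_Obj] eq[OF Cod_Obj] by (auto simp: hom_def)
  with assms(1) t show ?thesis by (rule is_terminal_eqI)
qed

section \<open>Test categories: the point and the walking arrow\<close>

definition const_functor :: "('o, 'a) cat \<Rightarrow> ('p, 'b) cat \<Rightarrow> 'p \<Rightarrow> ('o, 'a, 'p, 'b) funct" where
  "const_functor B C x =
    \<lparr>Src = B, Tgt = C, FObj = (\<lambda>_ \<in> Obj B. x), FArr = (\<lambda>_ \<in> Arr B. Ident C x)\<rparr>"

lemma const_functor_simps [simp]:
  "Src (const_functor B C x) = B" "Tgt (const_functor B C x) = C"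
  by (simp_all add: const_functor_def)

lemma is_functor_const:
  assumes "category B" "category C" "x \<in> Obj C"
  shows "is_functor (const_functor B C x)"
proof -
  interpret B: category B by fact
  interpret C: category C by fact
  have i: "Ident C x \<in> hom C x x" by (rule C.Ident_hom) fact
  show ?thesis
    using assms i homD[OF B.Ident_hom] B.Comp_hom[THEN homD(1)] C.Comp_Ident_left[OF i]
    by (intro is_functor.intro) (auto simp: const_functor_def B.hom_Obj dest: homD)
qed

lemma comp_const_functor:
  assumes "is_functor G" "Src G = C" "x \<in> Obj C"
  shows "comp_functor G (const_functor B C x) = const_functor B (Tgt G) (FObj G x)"
  using assms is_functor.FArr_Ident[OF assms(1)]
  by (auto simp: comp_functor_def const_functor_def compose_def fun_eq_iff)

text \<open>The terminal category; functors out of it correspond to objects. It is built on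
  \<open>undefined\<close> because every type contains that element, so it exists in every
  universe.\<close>

definition point_cat :: "('o, 'a) cat" where
  "point_cat = \<lparr>Obj = {undefined}, Arr = {undefined}, Dom = (\<lambda>_. undefined),
    Cod = (\<lambda>_. undefined), Ident = (\<lambda>_. undefined), Comp = (\<lambda>_ _. undefined)\<rparr>"

lemma category_point_cat: "category point_cat"
  by (rule category.intro) (auto simp: point_cat_def hom_def)

lemma const_functor_point_inject:
  assumes "const_functor point_cat C x = const_functor point_cat C y"
  shows "x = y"
  using arg_cong[OF assms, of "\<lambda>F. FObj F undefined"]
  by (simp add: const_functor_def point_cat_def)

text \<open>The parameters are the elements that the universe must provide: \<open>s\<close> and
  \<open>t\<close> become source and target, \<open>i\<close> and \<open>k\<close> their identities,
  and \<open>e\<close> the only other arrow.\<close>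

locale walking_arrow =
  fixes s t :: 'o and i k e :: 'a
  assumes s_t: "s \<noteq> t" and distinct: "distinct [i, k, e]"
begin

text \<open>The formula for \<open>Comp\<close> is right on composable pairs: only \<open>i\<close>
  can precede \<open>e\<close>, and in all other cases the left factor \<open>g\<close> is an
  identity.\<close>

definition walking_cat :: "('o, 'a) cat" where
  "walking_cat = \<lparr>Obj = {s, t}, Arr = {i, k, e}, Dom = (\<lambda>f. if f = k then t else s),
    Cod = (\<lambda>f. if f = i then s else t), Ident = (\<lambda>x. if x = s then i else k),
    Comp = (\<lambda>g f. if g = e then e else f)\<rparr>"

lemma category_walking_cat: "category walking_cat"
  using s_t distinct
  by (intro category.intro) (auto simp: walking_cat_def hom_def split: if_splits)

text \<open>The functor out of the walking arrow that corresponds to \<open>f\<close>. Evaluation at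
  \<open>e\<close> recovers \<open>f\<close>, so equality of such functors gives equality of
  arrows.\<close>

definition pick :: "('p, 'b) cat \<Rightarrow> 'b \<Rightarrow> ('o, 'a, 'p, 'b) funct" where
  "pick C f = \<lparr>Src = walking_cat, Tgt = C,
    FObj = (\<lambda>x \<in> {s, t}. if x = s then Dom C f else Cod C f),
    FArr = (\<lambda>a \<in> {i, k, e}. if a = i then Ident C (Dom C f)
      else if a = k then Ident C (Cod C f) else f)\<rparr>"

lemma pick_simps [simp]: "Src (pick C f) = walking_cat" "Tgt (pick C f) = C"
  by (simp_all add: pick_def)

lemma FArr_pick [simp]: "FArr (pick C f) e = f"
  using distinct by (auto simp: pick_def)

lemma is_functor_pick:
  assumes "category C" "f \<in> Arr C"
  shows "is_functor (pick C f)"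
proof -
  interpret C: category C by fact
  have d: "Dom C f \<in> Obj C" and c: "Cod C f \<in> Obj C"
    using assms(2) C.Dom_Obj C.Cod_Obj by auto
  note f = hom_Arr[OF assms(2)]
  note i = C.Ident_hom[OF d] and k = C.Ident_hom[OF c]
  note eqs = C.Comp_Ident_left[OF f] C.Comp_Ident_right[OF f]
    C.Comp_Ident_left[OF i] C.Comp_Ident_left[OF k]
  show ?thesis
    using s_t distinct assms(1) category_walking_cat d c f i k eqs
    by (intro is_functor.intro)
      (auto simp: pick_def walking_cat_def hom_def split: if_splits)
qed

text \<open>Naturality of the correspondence between arrows and functors out of the walking arrow.
  It reduces the cone equations for a family of \<open>pick\<close> functors to compatibility of the
  arrows.\<close>

lemma comp_pick:
  assumes "is_functor G" "Src G = C" "f \<in> Arr C"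
  shows "comp_functor G (pick C f) = pick (Tgt G) (FArr G f)"
proof -
  interpret G: is_functor G by fact
  interpret C: category C using G.category_Src assms(2) by simp
  have "Dom C f \<in> Obj C" "Cod C f \<in> Obj C" using assms(3) C.Dom_Obj C.Cod_Obj by auto
  then show ?thesis
    using assms G.FArr_Arr[of f] G.FArr_Ident
    by (auto simp: comp_functor_def pick_def walking_cat_def compose_def fun_eq_iff)
qed

end

section \<open>Limits in \<open>Cat\<close>: legs, mediating functors and objects\<close>

locale cat_limit =
  fixes D :: "('i, 'k, ('o, 'a) cat, ('o, 'a, 'o, 'a) funct) funct"
    and L :: "('o, 'a) cat"
    and leg :: "'i \<Rightarrow> ('o, 'a, 'o, 'a) funct"
  assumes diagram: "is_functor D" and Tgt_D: "Tgt D = Cat"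
    and limit: "is_limit D L leg"
begin

lemma category_D: "j \<in> Obj (Src D) \<Longrightarrow> category (FObj D j)"
  using is_functor.FObj_Obj[OF diagram] Tgt_D by (auto simp: Cat_def)

lemma action:
  assumes "\<alpha> \<in> Arr (Src D)"
  shows "is_functor (FArr D \<alpha>)" "Src (FArr D \<alpha>) = FObj D (Dom (Src D) \<alpha>)"
    "Tgt (FArr D \<alpha>) = FObj D (Cod (Src D) \<alpha>)"
  using is_functor.FArr_Arr[OF diagram assms] Tgt_D by (auto simp: Cat_def)

lemma index:
  assumes "\<alpha> \<in> Arr (Src D)"
  shows "Dom (Src D) \<alpha> \<in> Obj (Src D)" "Cod (Src D) \<alpha> \<in> Obj (Src D)"
  using category.Dom_Obj[OF is_functor.category_Src[OF diagram] assms]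
    category.Cod_Obj[OF is_functor.category_Src[OF diagram] assms] by auto

lemma category_L: "category L"
  using limit Tgt_D by (auto simp: is_limit_def is_cone_def Cat_def)

lemma legs:
  assumes "j \<in> Obj (Src D)"
  shows "is_functor (leg j)" "Src (leg j) = L" "Tgt (leg j) = FObj D j"
  using limit Tgt_D assms by (auto simp: is_limit_def is_cone_def Cat_def hom_def)

lemma comp_action_leg:
  assumes "\<alpha> \<in> Arr (Src D)"
  shows "comp_functor (FArr D \<alpha>) (leg (Dom (Src D) \<alpha>)) = leg (Cod (Src D) \<alpha>)"
  using limit Tgt_D assms by (auto simp: is_limit_def is_cone_def Cat_def)

lemma action_leg_Obj:
  assumes "\<alpha> \<in> Arr (Src D)" "x \<in> Obj L"
  shows "FObj (FArr D \<alpha>) (FObj (leg (Dom (Src D) \<alpha>)) x) = FObj (leg (Cod (Src D) \<alpha>)) x"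
  using assms legs(2)[OF index(1)[OF assms(1)]]
  by (simp flip: comp_action_leg add: comp_functor_def compose_def)

lemma action_leg_Arr:
  assumes "\<alpha> \<in> Arr (Src D)" "f \<in> Arr L"
  shows "FArr (FArr D \<alpha>) (FArr (leg (Dom (Src D) \<alpha>)) f) = FArr (leg (Cod (Src D) \<alpha>)) f"
  using assms legs(2)[OF index(1)[OF assms(1)]]
  by (simp flip: comp_action_leg add: comp_functor_def compose_def)

lemma leg_Obj:
  assumes "j \<in> Obj (Src D)" "x \<in> Obj L"
  shows "FObj (leg j) x \<in> Obj (FObj D j)"
  using is_functor.FObj_Obj[OF legs(1)[OF assms(1)]] legs[OF assms(1)] assms(2) by simp

lemma leg_Arr:
  assumes "j \<in> Obj (Src D)" "f \<in> Arr L"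
  shows "FArr (leg j) f \<in> Arr (FObj D j)"
    and "Dom (FObj D j) (FArr (leg j) f) = FObj (leg j) (Dom L f)"
    and "Cod (FObj D j) (FArr (leg j) f) = FObj (leg j) (Cod L f)"
  using is_functor.FArr_Arr[OF legs(1)[OF assms(1)]] legs[OF assms(1)] assms(2) by simp_all

lemma leg_hom:
  assumes "j \<in> Obj (Src D)" "f \<in> hom L x y"
  shows "FArr (leg j) f \<in> hom (FObj D j) (FObj (leg j) x) (FObj (leg j) y)"
  using is_functor.FArr_hom[OF legs(1)[OF assms(1)]] legs[OF assms(1)] assms(2) by simp

lemma leg_Comp:
  assumes "j \<in> Obj (Src D)" "f \<in> hom L x y" "g \<in> hom L y z"
  shows "FArr (leg j) (Comp L g f) = Comp (FObj D j) (FArr (leg j) g) (FArr (leg j) f)"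
  using is_functor.FArr_Comp[OF legs(1)[OF assms(1)]] legs[OF assms(1)] assms(2,3) by simp

lemma action_hom:
  assumes "\<alpha> \<in> Arr (Src D)" "f \<in> hom (FObj D (Dom (Src D) \<alpha>)) x y"
  shows "FArr (FArr D \<alpha>) f \<in> hom (FObj D (Cod (Src D) \<alpha>)) (FObj (FArr D \<alpha>) x) (FObj (FArr D \<alpha>) y)"
  using is_functor.FArr_hom[OF action(1)[OF assms(1)]] action[OF assms(1)] assms(2) by simp

lemma action_Comp:
  assumes "\<alpha> \<in> Arr (Src D)" "f \<in> hom (FObj D (Dom (Src D) \<alpha>)) x y"
    and "g \<in> hom (FObj D (Dom (Src D) \<alpha>)) y z"
  shows "FArr (FArr D \<alpha>) (Comp (FObj D (Dom (Src D) \<alpha>)) g f) =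
    Comp (FObj D (Cod (Src D) \<alpha>)) (FArr (FArr D \<alpha>) g) (FArr (FArr D \<alpha>) f)"
  using is_functor.FArr_Comp[OF action(1)[OF assms(1)]] action[OF assms(1)] assms(2,3) by simp

text \<open>The existence half of the universal property, with the arrows of \<open>Cat\<close>
  unfolded to functors. The test category \<open>X\<close> has the same object and arrow types as
  \<open>L\<close>, since both are objects of the same \<open>Cat\<close>.\<close>

lemma limit_map_ex:
  fixes X :: "('o, 'a) cat"
  assumes "category X"
    and "\<And>j. j \<in> Obj (Src D) \<Longrightarrow> is_functor (\<xi> j) \<and> Src (\<xi> j) = X \<and> Tgt (\<xi> j) = FObj D j"
    and "\<And>\<alpha>. \<alpha> \<in> Arr (Src D) \<Longrightarrow>
      comp_functor (FArr D \<alpha>) (\<xi> (Dom (Src D) \<alpha>)) = \<xi> (Cod (Src D) \<alpha>)"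
  obtains u where "is_functor u" "Src u = X" "Tgt u = L"
    "\<And>j. j \<in> Obj (Src D) \<Longrightarrow> comp_functor (leg j) u = \<xi> j"
proof -
  have "is_cone D X \<xi>"
    using assms Tgt_D by (auto simp: is_cone_def Cat_def hom_def)
  then have "\<exists>!u. u \<in> hom (Tgt D) X L \<and> (\<forall>j \<in> Obj (Src D). Comp (Tgt D) (leg j) u = \<xi> j)"
    using limit unfolding is_limit_def by blast
  then obtain u where "u \<in> hom (Tgt D) X L" "\<forall>j \<in> Obj (Src D). Comp (Tgt D) (leg j) u = \<xi> j"
    by blast
  with that[of u] Tgt_D show thesis by (auto simp: Cat_def hom_def)
qed

text \<open>By associativity in \<open>Cat\<close> the composites of the legs with \<open>u\<close>
  form a cone, and \<open>u\<close> and \<open>v\<close> both factor it through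
  \<open>L\<close>.\<close>

lemma limit_map_eqI:
  fixes X :: "('o, 'a) cat"
  assumes u: "is_functor u" "Src u = X" "Tgt u = L"
    and v: "is_functor v" "Src v = X" "Tgt v = L"
    and eq: "\<And>j. j \<in> Obj (Src D) \<Longrightarrow> comp_functor (leg j) u = comp_functor (leg j) v"
  shows "u = v"
proof -
  let ?\<xi> = "\<lambda>j. comp_functor (leg j) u"
  have u': "u \<in> hom Cat X L" and v': "v \<in> hom Cat X L"
    using u v by (simp_all add: hom_def Cat_def)
  have "category X" using is_functor.category_Src[OF u(1)] u(2) by simp
  moreover have "?\<xi> j \<in> hom Cat X (FObj D j)" if "j \<in> Obj (Src D)" for j
    using category.Comp_hom[OF category_Cat u', of "leg j"] legs[OF that]
    by (simp add: Cat_def hom_def)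
  moreover have "comp_functor (FArr D \<alpha>) (?\<xi> (Dom (Src D) \<alpha>)) = ?\<xi> (Cod (Src D) \<alpha>)"
    if "\<alpha> \<in> Arr (Src D)" for \<alpha>
    using category.Comp_assoc[OF category_Cat u', of "leg (Dom (Src D) \<alpha>)" _ "FArr D \<alpha>"]
      legs[OF index(1)[OF that]] action[OF that] comp_action_leg[OF that]
    by (simp add: Cat_def hom_def)
  ultimately have "is_cone D X ?\<xi>"
    by (simp add: is_cone_def Tgt_D) (simp add: Cat_def)
  then have "\<exists>!w. w \<in> hom (Tgt D) X L \<and> (\<forall>j \<in> Obj (Src D). Comp (Tgt D) (leg j) w = ?\<xi> j)"
    using limit unfolding is_limit_def by blast
  moreover have "\<forall>j \<in> Obj (Src D). Comp (Tgt D) (leg j) u = ?\<xi> j"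
    "\<forall>j \<in> Obj (Src D). Comp (Tgt D) (leg j) v = ?\<xi> j"
    using eq by (simp_all add: Tgt_D Cat_def)
  ultimately show ?thesis using u'[folded Tgt_D] v'[folded Tgt_D] by blast
qed

text \<open>The legs agree on the two constant functors out of the point, which uniqueness then
  identifies.\<close>

lemma Obj_eqI:
  assumes "x \<in> Obj L" "y \<in> Obj L"
    and "\<And>j. j \<in> Obj (Src D) \<Longrightarrow> FObj (leg j) x = FObj (leg j) y"
  shows "x = y"
proof -
  have "const_functor (point_cat :: ('o, 'a) cat) L x = const_functor point_cat L y"
    by (rule limit_map_eqI)
      (use assms legs in \<open>simp_all add: is_functor_const category_point_cat category_L
        comp_const_functor\<close>)
  then show ?thesis by (rule const_functor_point_inject)
qed

text \<open>A compatible family of objects is a cone with the point as apex; the object sought is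
  the value of the mediating functor at the single object.\<close>

lemma Obj_lift:
  assumes "\<And>j. j \<in> Obj (Src D) \<Longrightarrow> x j \<in> Obj (FObj D j)"
    and "\<And>\<alpha>. \<alpha> \<in> Arr (Src D) \<Longrightarrow> FObj (FArr D \<alpha>) (x (Dom (Src D) \<alpha>)) = x (Cod (Src D) \<alpha>)"
  obtains y where "y \<in> Obj L" "\<And>j. j \<in> Obj (Src D) \<Longrightarrow> FObj (leg j) y = x j"
proof -
  let ?\<xi> = "\<lambda>j. const_functor point_cat (FObj D j) (x j)"
  obtain u :: "('o, 'a, 'o, 'a) funct" where u: "is_functor u" "Src u = point_cat" "Tgt u = L"
    "\<And>j. j \<in> Obj (Src D) \<Longrightarrow> comp_functor (leg j) u = ?\<xi> j"
  proof (rule limit_map_ex[of point_cat ?\<xi>])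
    show "comp_functor (FArr D \<alpha>) (?\<xi> (Dom (Src D) \<alpha>)) = ?\<xi> (Cod (Src D) \<alpha>)"
      if "\<alpha> \<in> Arr (Src D)" for \<alpha>
      using that assms action index by (simp add: comp_const_functor)
  qed (auto simp: category_point_cat is_functor_const category_D assms(1))
  show thesis
  proof
    show "FObj u undefined \<in> Obj L"
      using is_functor.FObj_Obj[OF u(1), of undefined] u(2,3) by (simp add: point_cat_def)
    show "FObj (leg j) (FObj u undefined) = x j" if "j \<in> Obj (Src D)" for j
      using arg_cong[OF u(4)[OF that], of "\<lambda>F. FObj F undefined"] u(2)
      by (simp add: comp_functor_def const_functor_def compose_def point_cat_def)
  qed
qed

end

section \<open>Arrows of the limit as compatible families of arrows\<close>

locale cat_limit_terminal = cat_limit D L leg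
  for D :: "('i, 'k, ('o, 'a) cat, ('o, 'a, 'o, 'a) funct) funct"
    and L :: "('o, 'a) cat"
    and leg :: "'i \<Rightarrow> ('o, 'a, 'o, 'a) funct" +
  fixes one :: "'i \<Rightarrow> 'o"
  assumes terminal: "j \<in> Obj (Src D) \<Longrightarrow> is_terminal (FObj D j) (one j)"
begin

text \<open>Here the terminal objects make up for the size of the universe: when it is too small for
  a walking arrow, each component has at most one arrow.\<close>

lemma trivial_D:
  assumes "\<not> (\<exists>x y :: 'o. x \<noteq> y) \<or> \<not> (\<exists>p q r :: 'a. distinct [p, q, r])"
    and "j \<in> Obj (Src D)" "f \<in> Arr (FObj D j)" "g \<in> Arr (FObj D j)"
  shows "f = g"
  using category.trivial_if_terminal[OF category_D[OF assms(2)] terminal[OF assms(2)]] assms by blast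

text \<open>With a walking arrow available, the functors picking \<open>f\<close> and
  \<open>g\<close> are identified as for objects. Otherwise every arrow of \<open>L\<close> turns
  out to be an identity, so comparing domains suffices.\<close>

lemma Arr_eqI:
  assumes f: "f \<in> Arr L" and g: "g \<in> Arr L"
    and eq: "\<And>j. j \<in> Obj (Src D) \<Longrightarrow> FArr (leg j) f = FArr (leg j) g"
  shows "f = g"
proof (cases "(\<exists>x y :: 'o. x \<noteq> y) \<and> (\<exists>p q r :: 'a. distinct [p, q, r])")
  case True
  then obtain s t :: 'o and i k e :: 'a where "walking_arrow s t i k e"
    unfolding walking_arrow_def by blast
  then interpret walking_arrow s t i k e .
  have "pick L f = pick L g"
    by (rule limit_map_eqI)
      (use assms legs in \<open>simp_all add: is_functor_pick category_L comp_pick\<close>)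
  then have "FArr (pick L f) e = FArr (pick L g) e" by simp
  then show ?thesis by simp
next
  case False
  interpret L: category L by (rule category_L)
  txt \<open>The legs do not separate the identity functor of \<open>L\<close> from a constant functor.\<close>
  have Ident: "h = Ident L (Dom L h)" if h: "h \<in> Arr L" for h
  proof -
    note x = L.Dom_Obj[OF h]
    let ?c = "const_functor L L (Dom L h)"
    have c: "is_functor ?c" using category_L x by (intro is_functor_const)
    have "id_functor L = ?c"
    proof (rule limit_map_eqI)
      fix j assume j: "j \<in> Obj (Src D)"
      interpret l: is_functor "leg j" by (rule legs(1)[OF j])
      interpret Dj: category "FObj D j" by (rule category_D[OF j])
      \<comment> \<open>Both sides are arrows of \<open>FObj D j\<close>, which has at most
        one.\<close>
      have arr: "FArr (leg j) k = Ident (FObj D j) (FObj (leg j) (Dom L h))" if "k \<in> Arr L" for k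
        using trivial_D[of j] False j leg_Arr(1)[OF j that] homD(1)[OF Dj.Ident_hom]
          leg_Obj[OF j x] by blast
      \<comment> \<open>Objects are recovered from their identities: the leg sends both identities
        to the same arrow, whose domain is the image of either object.\<close>
      have obj: "FObj (leg j) y = FObj (leg j) (Dom L h)" if y: "y \<in> Obj L" for y
      proof -
        have "FArr (leg j) (Ident L y) = FArr (leg j) (Ident L (Dom L h))"
          using arr homD(1)[OF L.Ident_hom] y x by metis
        then show ?thesis
          using leg_Arr(2)[OF j] homD(1,2)[OF L.Ident_hom[OF y]] homD(1,2)[OF L.Ident_hom[OF x]]
          by metis
      qed
      show "comp_functor (leg j) (id_functor L) = comp_functor (leg j) ?c"
        using arr x homD(1)[OF L.Ident_hom[OF x]]
        by (auto simp: legs[OF j] comp_functor_def id_functor_def const_functor_def compose_def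
            fun_eq_iff intro: obj)
    qed (use c is_functor_id[OF category_L] in \<open>auto simp: id_functor_def const_functor_def\<close>)
    then have "FArr (id_functor L) h = FArr ?c h" by simp
    then show ?thesis using h by (simp add: id_functor_def const_functor_def)
  qed
  have "Dom L f = Dom L g"
    by (rule Obj_eqI) (use L.Dom_Obj f g leg_Arr(2) eq in metis)+
  then show ?thesis using Ident f g by metis
qed

text \<open>A compatible family is a cone with the walking arrow as apex, if there is one, and the
  mediating functor evaluated at \<open>e\<close> is the lift.\<close>

lemma Arr_lift:
  assumes f: "\<And>j. j \<in> Obj (Src D) \<Longrightarrow> f j \<in> Arr (FObj D j)"
    and compat: "\<And>\<alpha>. \<alpha> \<in> Arr (Src D) \<Longrightarrow> FArr (FArr D \<alpha>) (f (Dom (Src D) \<alpha>)) = f (Cod (Src D) \<alpha>)"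
  obtains h where "h \<in> Arr L" "\<And>j. j \<in> Obj (Src D) \<Longrightarrow> FArr (leg j) h = f j"
proof (cases "(\<exists>x y :: 'o. x \<noteq> y) \<and> (\<exists>p q r :: 'a. distinct [p, q, r])")
  case True
  then obtain s t :: 'o and i k e :: 'a where "walking_arrow s t i k e"
    unfolding walking_arrow_def by blast
  then interpret walking_arrow s t i k e .
  let ?\<xi> = "\<lambda>j. pick (FObj D j) (f j)"
  obtain u where u: "is_functor u" "Src u = walking_cat" "Tgt u = L"
    "\<And>j. j \<in> Obj (Src D) \<Longrightarrow> comp_functor (leg j) u = ?\<xi> j"
  proof (rule limit_map_ex[of walking_cat ?\<xi>])
    show "comp_functor (FArr D \<alpha>) (?\<xi> (Dom (Src D) \<alpha>)) = ?\<xi> (Cod (Src D) \<alpha>)"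
      if "\<alpha> \<in> Arr (Src D)" for \<alpha>
      using that assms action index by (simp add: comp_pick)
  qed (auto simp: category_walking_cat is_functor_pick category_D f)
  have e: "e \<in> Arr walking_cat" by (simp add: walking_cat_def)
  show thesis
  proof (rule that)
    show "FArr u e \<in> Arr L"
      using is_functor.FArr_Arr(1)[OF u(1), of e] u(2,3) e by simp
    show "FArr (leg j) (FArr u e) = f j" if "j \<in> Obj (Src D)" for j
    proof -
      have "FArr (comp_functor (leg j) u) e = FArr (?\<xi> j) e"
        using u(4)[OF that] by simp
      then show ?thesis
        using u(2) e by (simp add: comp_functor_def compose_def)
    qed
  qed
next
  case False
  \<comment> \<open>Without a walking arrow, the domains of the \<open>f j\<close> are lifted to an
    object instead; its identity is sent to \<open>f j\<close> because each component has at most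
    one arrow.\<close>
  obtain x where x: "x \<in> Obj L" "\<And>j. j \<in> Obj (Src D) \<Longrightarrow> FObj (leg j) x = Dom (FObj D j) (f j)"
  proof (rule Obj_lift[of "\<lambda>j. Dom (FObj D j) (f j)"])
    show "FObj (FArr D \<alpha>) (Dom (FObj D (Dom (Src D) \<alpha>)) (f (Dom (Src D) \<alpha>))) =
        Dom (FObj D (Cod (Src D) \<alpha>)) (f (Cod (Src D) \<alpha>))" if \<alpha>: "\<alpha> \<in> Arr (Src D)" for \<alpha>
      using is_functor.FArr_Arr(2)[OF action(1)[OF \<alpha>], of "f (Dom (Src D) \<alpha>)"]
        action[OF \<alpha>] f[OF index(1)[OF \<alpha>]] compat[OF \<alpha>] by simp
  qed (use category.Dom_Obj[OF category_D] f in auto)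
  have i: "Ident L x \<in> Arr L"
    using homD(1)[OF category.Ident_hom[OF category_L x(1)]] .
  show thesis
  proof (rule that[OF i])
    show "FArr (leg j) (Ident L x) = f j" if j: "j \<in> Obj (Src D)" for j
      using trivial_D[OF _ j leg_Arr(1)[OF j i] f[OF j]] False by blast
  qed
qed

text \<open>Legs preserve domains and codomains and jointly separate objects, so the lifted arrow
  has the prescribed endpoints.\<close>

lemma hom_lift:
  assumes f: "\<And>j. j \<in> Obj (Src D) \<Longrightarrow> f j \<in> hom (FObj D j) (FObj (leg j) x) (FObj (leg j) y)"
    and compat: "\<And>\<alpha>. \<alpha> \<in> Arr (Src D) \<Longrightarrow> FArr (FArr D \<alpha>) (f (Dom (Src D) \<alpha>)) = f (Cod (Src D) \<alpha>)"
    and x: "x \<in> Obj L" and y: "y \<in> Obj L"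
  obtains h where "h \<in> hom L x y" "\<And>j. j \<in> Obj (Src D) \<Longrightarrow> FArr (leg j) h = f j"
proof -
  obtain h where h: "h \<in> Arr L" "\<And>j. j \<in> Obj (Src D) \<Longrightarrow> FArr (leg j) h = f j"
    using Arr_lift[OF homD(1)[OF f] compat] by blast
  have "Dom L h = x"
    by (rule Obj_eqI)
      (use h x category.Dom_Obj[OF category_L] homD[OF f] leg_Arr(2)[OF _ h(1)] in auto)+
  moreover have "Cod L h = y"
    by (rule Obj_eqI)
      (use h y category.Cod_Obj[OF category_L] homD[OF f] leg_Arr(3)[OF _ h(1)] in auto)+
  ultimately show thesis using that h by (auto simp: hom_def)
qed

section \<open>Universal properties lifted from the components to the limit\<close>

lemma is_terminal_lift:
  assumes t: "t \<in> Obj L" and one: "\<And>j. j \<in> Obj (Src D) \<Longrightarrow> FObj (leg j) t = one j"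
  shows "is_terminal L t"
  unfolding is_terminal_def
proof (intro conjI ballI t)
  fix x assume x: "x \<in> Obj L"
  have uniq: "f = g" if "j \<in> Obj (Src D)" "f \<in> hom (FObj D j) (FObj (leg j) x) (one j)"
    "g \<in> hom (FObj D j) (FObj (leg j) x) (one j)" for j f g
    using is_terminal_eqI[OF terminal leg_Obj] that x by blast
  have "\<exists>f. f \<in> hom (FObj D j) (FObj (leg j) x) (one j)" if "j \<in> Obj (Src D)" for j
    using terminal[OF that] leg_Obj[OF that x] by (auto simp: is_terminal_def)
  then obtain b where b: "\<And>j. j \<in> Obj (Src D) \<Longrightarrow> b j \<in> hom (FObj D j) (FObj (leg j) x) (one j)"
    by metis
  \<comment> \<open>The action sends \<open>one\<close> at the domain of \<open>\<alpha>\<close> to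
    \<open>one\<close> at its codomain, since both are images of \<open>t\<close> under legs. Hence
    the two sides are parallel maps into a terminal object.\<close>
  have "FArr (FArr D \<alpha>) (b (Dom (Src D) \<alpha>)) = b (Cod (Src D) \<alpha>)" if \<alpha>: "\<alpha> \<in> Arr (Src D)" for \<alpha>
  proof (rule uniq[OF index(2)[OF \<alpha>] _ b[OF index(2)[OF \<alpha>]]])
    show "FArr (FArr D \<alpha>) (b (Dom (Src D) \<alpha>)) \<in>
        hom (FObj D (Cod (Src D) \<alpha>)) (FObj (leg (Cod (Src D) \<alpha>)) x) (one (Cod (Src D) \<alpha>))"
      using action_hom[OF \<alpha> b[OF index(1)[OF \<alpha>]]] action_leg_Obj[OF \<alpha>] t x one index[OF \<alpha>]
      by metis
  qed
  moreover have "b j \<in> hom (FObj D j) (FObj (leg j) x) (FObj (leg j) t)" if "j \<in> Obj (Src D)" for j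
    using b[OF that] one[OF that] by simp
  ultimately obtain h where h: "h \<in> hom L x t"
    using hom_lift[of b x t] x t by blast
  show "\<exists>!f. f \<in> hom L x t"
  proof (rule ex1I[of _ h], rule h)
    show "f = h" if "f \<in> hom L x t" for f
      by (rule Arr_eqI)
        (use uniq leg_hom[OF _ that] leg_hom[OF _ h] one homD(1)[OF that] homD(1)[OF h] in auto)+
  qed
qed

text \<open>The mediating maps of the components are compatible, by their uniqueness, and so lift.
  The legs separate arrows, so the equations and the uniqueness in \<open>L\<close> can be checked
  in the components.\<close>

lemma is_pullback_lift:
  assumes p: "p \<in> hom L v x" and q: "q \<in> hom L v y" and f: "f \<in> hom L x z" and g: "g \<in> hom L y z"
    and pb: "\<And>j. j \<in> Obj (Src D) \<Longrightarrow> is_pullback (FObj D j)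
      (FArr (leg j) p) (FArr (leg j) q) (FArr (leg j) f) (FArr (leg j) g)"
  shows "is_pullback L p q f g"
proof -
  interpret L: category L by (rule category_L)
  note homs = homD[OF p] homD[OF q] homD[OF f] homD[OF g]
  have comm: "Comp L f p = Comp L g q"
  proof (rule Arr_eqI)
    show "FArr (leg j) (Comp L f p) = FArr (leg j) (Comp L g q)" if j: "j \<in> Obj (Src D)" for j
      using leg_Comp[OF j p f] leg_Comp[OF j q g] pb[OF j] by (simp add: is_pullback_def)
  qed (use homD(1)[OF L.Comp_hom] p q f g in blast)+
  have "\<exists>!u. u \<in> hom L w v \<and> Comp L p u = a \<and> Comp L q u = b"
    if a: "a \<in> hom L w x" and b: "b \<in> hom L w y" and ab: "Comp L f a = Comp L g b" for w a b
  proof -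
    let ?M = "\<lambda>j u. u \<in> hom (FObj D j) (FObj (leg j) w) (FObj (leg j) v) \<and>
      Comp (FObj D j) (FArr (leg j) p) u = FArr (leg j) a \<and>
      Comp (FObj D j) (FArr (leg j) q) u = FArr (leg j) b"
    have M: "\<exists>!u. ?M j u" if j: "j \<in> Obj (Src D)" for j
    proof -
      have "Comp (FObj D j) (FArr (leg j) f) (FArr (leg j) a) =
          Comp (FObj D j) (FArr (leg j) g) (FArr (leg j) b)"
        using leg_Comp[OF j a f] leg_Comp[OF j b g] ab by simp
      from is_pullback_ex1[OF pb[OF j] _ _ this, of "FObj (leg j) w"]
      show ?thesis
        using leg_hom[OF j a] leg_hom[OF j b] leg_Arr(2)[OF j] homs by simp
    qed
    then obtain u where u: "\<And>j. j \<in> Obj (Src D) \<Longrightarrow> ?M j (u j)" by metis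
    \<comment> \<open>The action turns the mediating map at the domain of \<open>\<alpha>\<close>
      into a map that satisfies the mediating equations at the codomain.\<close>
    have compat: "FArr (FArr D \<alpha>) (u (Dom (Src D) \<alpha>)) = u (Cod (Src D) \<alpha>)"
      if \<alpha>: "\<alpha> \<in> Arr (Src D)" for \<alpha>
    proof -
      let ?d = "Dom (Src D) \<alpha>" and ?c = "Cod (Src D) \<alpha>"
      note d = index(1)[OF \<alpha>] and c = index(2)[OF \<alpha>]
      have ud: "u ?d \<in> hom (FObj D ?d) (FObj (leg ?d) w) (FObj (leg ?d) v)" using u[OF d] by blast
      have "FArr (FArr D \<alpha>) (u ?d) \<in> hom (FObj D ?c) (FObj (leg ?c) w) (FObj (leg ?c) v)"
        using action_hom[OF \<alpha> ud] action_leg_Obj[OF \<alpha>] L.hom_Obj[OF a] L.hom_Obj[OF p] by simp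
      moreover have "Comp (FObj D ?c) (FArr (leg ?c) p) (FArr (FArr D \<alpha>) (u ?d)) = FArr (leg ?c) a"
        using action_Comp[OF \<alpha> ud leg_hom[OF d p]] u[OF d] action_leg_Arr[OF \<alpha>] homs homD(1)[OF a]
        by simp
      moreover have "Comp (FObj D ?c) (FArr (leg ?c) q) (FArr (FArr D \<alpha>) (u ?d)) = FArr (leg ?c) b"
        using action_Comp[OF \<alpha> ud leg_hom[OF d q]] u[OF d] action_leg_Arr[OF \<alpha>] homs homD(1)[OF b]
        by simp
      ultimately show ?thesis using M[OF c] u[OF c] by blast
    qed
    obtain h where h: "h \<in> hom L w v" "\<And>j. j \<in> Obj (Src D) \<Longrightarrow> FArr (leg j) h = u j"
      using hom_lift[of u w v] u compat L.hom_Obj[OF a] L.hom_Obj[OF p] by blast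
    show ?thesis
    proof (rule ex1I[of _ h], intro conjI)
      show "Comp L p h = a"
        by (rule Arr_eqI)
          (use homD(1)[OF L.Comp_hom[OF h(1) p]] homD(1)[OF a] leg_Comp[OF _ h(1) p] h(2) u in auto)+
      show "Comp L q h = b"
        by (rule Arr_eqI)
          (use homD(1)[OF L.Comp_hom[OF h(1) q]] homD(1)[OF b] leg_Comp[OF _ h(1) q] h(2) u in auto)+
    next
      fix k assume k: "k \<in> hom L w v \<and> Comp L p k = a \<and> Comp L q k = b"
      then have k': "k \<in> hom L w v" by blast
      show "k = h"
      proof (rule Arr_eqI)
        fix j assume j: "j \<in> Obj (Src D)"
        have "?M j (FArr (leg j) k)"
          using k leg_hom[OF j k'] leg_Comp[OF j k' p] leg_Comp[OF j k' q] by auto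
        then show "FArr (leg j) k = FArr (leg j) h" using M[OF j] u[OF j] h(2)[OF j] by metis
      qed (use homD(1)[OF k'] homD(1)[OF h(1)] in blast)+
    qed (rule h(1))
  qed
  then show ?thesis using comm homs by (simp add: is_pullback_def)
qed

text \<open>The characteristic maps of the leg images of a mono are compatible: an action carries a
  classifying square to a pullback square over the truth map at its target, where the characteristic
  map is unique. Their lift classifies the mono because pullbacks lift, and it is the only such map
  because legs preserve pullbacks.\<close>

lemma is_subobject_classifier_lift:
  fixes Om :: "'i \<Rightarrow> 'o" and tr :: "'i \<Rightarrow> 'a"
  assumes leg_pullbacks: "\<And>j. j \<in> Obj (Src D) \<Longrightarrow> preserves_pullbacks (leg j)"
    and action_pullbacks: "\<And>\<alpha>. \<alpha> \<in> Arr (Src D) \<Longrightarrow> preserves_pullbacks (FArr D \<alpha>)"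
    and classifiers: "\<And>j. j \<in> Obj (Src D) \<Longrightarrow>
      is_subobject_classifier (FObj D j) (one j) (Om j) (tr j)"
    and true: "true \<in> hom L t \<Omega>"
    and leg_t: "\<And>j. j \<in> Obj (Src D) \<Longrightarrow> FObj (leg j) t = one j"
    and leg_\<Omega>: "\<And>j. j \<in> Obj (Src D) \<Longrightarrow> FObj (leg j) \<Omega> = Om j"
    and leg_true: "\<And>j. j \<in> Obj (Src D) \<Longrightarrow> FArr (leg j) true = tr j"
  shows "is_subobject_classifier L t \<Omega> true"
proof -
  interpret L: category L by (rule category_L)
  note t = L.hom_Obj(1)[OF true] and \<Omega> = L.hom_Obj(2)[OF true]
  have terminal_t: "is_terminal L t" using t leg_t by (rule is_terminal_lift)
  have "\<exists>!\<chi>. \<chi> \<in> hom L (Cod L m) \<Omega> \<and> (\<exists>u \<in> hom L (Dom L m) t. is_pullback L m u \<chi> true)"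
    if mono: "is_mono L m" for m
  proof -
    let ?x = "Dom L m" and ?y = "Cod L m"
    have m: "m \<in> hom L ?x ?y" using mono by (simp add: is_mono_def hom_def)
    note mA = homD(1)[OF m] and x = L.hom_Obj(1)[OF m] and y = L.hom_Obj(2)[OF m]
    obtain u where u: "u \<in> hom L ?x t" using terminal_t x by (auto simp: is_terminal_def)
    let ?P = "\<lambda>j \<chi>. \<chi> \<in> hom (FObj D j) (FObj (leg j) ?y) (Om j) \<and>
      is_pullback (FObj D j) (FArr (leg j) m) (FArr (leg j) u) \<chi> (tr j)"
    have leg_u: "FArr (leg j) u \<in> hom (FObj D j) (FObj (leg j) ?x) (one j)"
      if "j \<in> Obj (Src D)" for j
      using leg_hom[OF that u] leg_t[OF that] by simp
    have P: "\<exists>!\<chi>. ?P j \<chi>" if j: "j \<in> Obj (Src D)" for j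
    proof -
      have "is_mono (FObj D j) (FArr (leg j) m)"
        using is_functor.preserves_mono[OF legs(1)[OF j] leg_pullbacks[OF j]] legs[OF j] mono by simp
      from is_subobject_classifier_ex1[OF classifiers[OF j] this]
      have ex1: "\<exists>!\<chi>. \<chi> \<in> hom (FObj D j) (FObj (leg j) ?y) (Om j) \<and>
          (\<exists>u \<in> hom (FObj D j) (FObj (leg j) ?x) (one j).
            is_pullback (FObj D j) (FArr (leg j) m) u \<chi> (tr j))"
        unfolding leg_Arr(2,3)[OF j mA] .
      have "v = FArr (leg j) u" if "v \<in> hom (FObj D j) (FObj (leg j) ?x) (one j)" for v
        using is_terminal_eqI[OF terminal[OF j] leg_Obj[OF j x] that leg_u[OF j]] .
      with ex1 leg_u[OF j] show ?thesis by metis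
    qed
    then obtain \<chi> where \<chi>: "\<And>j. j \<in> Obj (Src D) \<Longrightarrow> ?P j (\<chi> j)" by metis
    have compat: "FArr (FArr D \<alpha>) (\<chi> (Dom (Src D) \<alpha>)) = \<chi> (Cod (Src D) \<alpha>)"
      if \<alpha>: "\<alpha> \<in> Arr (Src D)" for \<alpha>
    proof -
      let ?d = "Dom (Src D) \<alpha>" and ?c = "Cod (Src D) \<alpha>"
      note d = index(1)[OF \<alpha>] and c = index(2)[OF \<alpha>]
      \<comment> \<open>Writing \<open>tr\<close> at the domain of \<open>\<alpha>\<close> as the
        leg image of \<open>true\<close> lets the compatibility of legs with actions rewrite every
        side except the characteristic map.\<close>
      have "is_pullback (FObj D ?c) (FArr (FArr D \<alpha>) (FArr (leg ?d) m))
          (FArr (FArr D \<alpha>) (FArr (leg ?d) u)) (FArr (FArr D \<alpha>) (\<chi> ?d))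
          (FArr (FArr D \<alpha>) (FArr (leg ?d) true))"
        using action_pullbacks[OF \<alpha>] \<chi>[OF d] action[OF \<alpha>] leg_true[OF d]
        by (simp add: preserves_pullbacks_def)
      then have "is_pullback (FObj D ?c) (FArr (leg ?c) m) (FArr (leg ?c) u)
          (FArr (FArr D \<alpha>) (\<chi> ?d)) (tr ?c)"
        using action_leg_Arr[OF \<alpha>] mA homD(1)[OF u] homD(1)[OF true] leg_true[OF c] by simp
      moreover have "FArr (FArr D \<alpha>) (\<chi> ?d) \<in> hom (FObj D ?c) (FObj (leg ?c) ?y) (Om ?c)"
        using action_hom[OF \<alpha>] \<chi>[OF d] action_leg_Obj[OF \<alpha>] y \<Omega> leg_\<Omega>[OF c] leg_\<Omega>[OF d] by metis
      ultimately show ?thesis using P[OF c] \<chi>[OF c] by blast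
    qed
    have "\<chi> j \<in> hom (FObj D j) (FObj (leg j) ?y) (FObj (leg j) \<Omega>)" if "j \<in> Obj (Src D)" for j
      using \<chi>[OF that] leg_\<Omega>[OF that] by simp
    then obtain h where h: "h \<in> hom L ?y \<Omega>" "\<And>j. j \<in> Obj (Src D) \<Longrightarrow> FArr (leg j) h = \<chi> j"
      using hom_lift[of \<chi> ?y \<Omega>] compat y \<Omega> by blast
    have "is_pullback L m u h true"
      using is_pullback_lift[OF m u h(1) true] h(2) leg_true \<chi> by simp
    moreover have "k = h" if k: "k \<in> hom L ?y \<Omega>" and v: "v \<in> hom L ?x t"
      and pb: "is_pullback L m v k true" for k v
    proof (rule Arr_eqI)
      fix j assume j: "j \<in> Obj (Src D)"
      \<comment> \<open>Terminality of \<open>t\<close> brings the leg image of the competing square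
        into the form required by \<open>?P j\<close>.\<close>
      have "v = u" using is_terminal_eqI[OF terminal_t x v u] .
      then have "is_pullback (FObj D j) (FArr (leg j) m) (FArr (leg j) u) (FArr (leg j) k) (tr j)"
        using leg_pullbacks[OF j] pb
        by (auto simp: preserves_pullbacks_def legs(2,3)[OF j] simp flip: leg_true[OF j])
      then have "?P j (FArr (leg j) k)" using leg_hom[OF j k] leg_\<Omega>[OF j] by simp
      then show "FArr (leg j) k = FArr (leg j) h" using P[OF j] \<chi>[OF j] h(2)[OF j] by metis
    qed (use homD(1)[OF k] homD(1)[OF h(1)] in blast)+
    ultimately show ?thesis using h(1) u by blast
  qed
  with terminal_t \<Omega> true show ?thesis by (simp add: is_subobject_classifier_def)
qed

end

theorem lemma3p2:
  fixes J :: "('i, 'k) cat"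
    and D :: "('i, 'k, ('o, 'a) cat, ('o, 'a, 'o, 'a) funct) funct"
    and L :: "('o, 'a) cat"
    and leg :: "'i \<Rightarrow> ('o, 'a, 'o, 'a) funct"
    and one Om :: "'i \<Rightarrow> 'o"
    and tr :: "'i \<Rightarrow> 'a"
  assumes diagram: "is_functor D" "Src D = J" "Tgt D = Cat"
    and limit: "is_limit D L leg"
    and leg_pullbacks: "\<And>j. j \<in> Obj J \<Longrightarrow> preserves_pullbacks (leg j)"
    and classifiers: "\<And>j. j \<in> Obj J \<Longrightarrow>
      is_subobject_classifier (FObj D j) (one j) (Om j) (tr j)"
    and action_pullbacks: "\<And>\<alpha>. \<alpha> \<in> Arr J \<Longrightarrow> preserves_pullbacks (FArr D \<alpha>)"
    and action_true: "\<And>\<alpha> j j'. \<alpha> \<in> hom J j j' \<Longrightarrow> FArr (FArr D \<alpha>) (tr j) = tr j'"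
  shows "\<exists>t \<Omega> true.
    (is_terminal L t \<and> (\<forall>j \<in> Obj J. FObj (leg j) t = one j)) \<and>
    (\<Omega> \<in> Obj L \<and> (\<forall>j \<in> Obj J. FObj (leg j) \<Omega> = Om j) \<and>
      (\<forall>\<Omega>' \<in> Obj L. (\<forall>j \<in> Obj J. FObj (leg j) \<Omega>' = Om j) \<longrightarrow> \<Omega>' = \<Omega>)) \<and>
    (true \<in> hom L t \<Omega> \<and> (\<forall>j \<in> Obj J. FArr (leg j) true = tr j) \<and>
      (\<forall>true' \<in> hom L t \<Omega>. (\<forall>j \<in> Obj J. FArr (leg j) true' = tr j) \<longrightarrow> true' = true)) \<and>
    is_subobject_classifier L t \<Omega> true"
proof -
  interpret cat_limit D L leg
    using diagram limit by (intro cat_limit.intro)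
  have J [simp]: "Src D = J" by fact
  interpret cat_limit_terminal D L leg one
    using classifiers cat_limit_axioms
    by (intro cat_limit_terminal.intro cat_limit_terminal_axioms.intro)
      (simp_all add: is_subobject_classifier_def)
  have tr: "tr j \<in> hom (FObj D j) (one j) (Om j)" if "j \<in> Obj J" for j
    using classifiers[OF that] by (simp add: is_subobject_classifier_def)
  have "FArr (FArr D \<alpha>) (tr (Dom J \<alpha>)) = tr (Cod J \<alpha>)" if "\<alpha> \<in> Arr J" for \<alpha>
    using action_true[OF hom_Arr[OF that]] .
  \<comment> \<open>The family of truth maps is lifted first. Its domain and codomain then serve as
    \<open>t\<close> and \<open>\<Omega>\<close>, and legs send these to \<open>one j\<close> and
    \<open>Om j\<close> because they preserve domains and codomains.\<close>
  then obtain true where true: "true \<in> Arr L" "\<And>j. j \<in> Obj J \<Longrightarrow> FArr (leg j) true = tr j"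
    using Arr_lift[of tr] homD(1)[OF tr] by auto
  define t \<Omega> where "t = Dom L true" and "\<Omega> = Cod L true"
  have hom: "true \<in> hom L t \<Omega>" using true(1) by (simp add: hom_def t_def \<Omega>_def)
  have t: "FObj (leg j) t = one j" and \<Omega>: "FObj (leg j) \<Omega> = Om j" if "j \<in> Obj J" for j
    using leg_Arr(2,3)[of j, OF _ true(1)] homD[OF tr[OF that]] true(2)[OF that] that
    by (simp_all add: t_def \<Omega>_def)
  have cls: "is_subobject_classifier L t \<Omega> true"
    by (rule is_subobject_classifier_lift[where Om = Om and tr = tr, OF _ _ _ hom])
      (use leg_pullbacks action_pullbacks classifiers t \<Omega> true(2) in simp_all)
  then have terminal_t: "is_terminal L t" and \<Omega>_Obj: "\<Omega> \<in> Obj L"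
    by (simp_all add: is_subobject_classifier_def)
  have "\<Omega>' = \<Omega>" if "\<Omega>' \<in> Obj L" "\<forall>j \<in> Obj J. FObj (leg j) \<Omega>' = Om j" for \<Omega>'
    by (rule Obj_eqI) (use that \<Omega> \<Omega>_Obj in auto)
  moreover have "true' = true" if "true' \<in> hom L t \<Omega>" "\<forall>j \<in> Obj J. FArr (leg j) true' = tr j" for true'
    by (rule Arr_eqI) (use that true homD(1)[OF that(1)] in auto)
  ultimately show ?thesis
    using cls terminal_t \<Omega>_Obj hom t \<Omega> true(2) by (intro exI[of _ t] exI[of _ \<Omega>] exI[of _ true]) blast
qed

end
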